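(* Let $P\subset\mathbb{R}^n$ be a convex polytope, let $E$ be a minimal finite set of vectors containing all directions of edges of $P$ (so one nonzero vector for each edge direction, parallel edges counting as the same direction), and let $Z(P)$ be the zonotope generated by $E$. Then $$\text{mono-diam}(P)\le \text{mono-diam}(Z(P)) = |E| = \text{number of different edge directions of } P.$$
   Context: The zonotope generated by vectors $v^1,\dots,v^m$ is the Minkowski sum of the segments $[0,v^i]$. For a polytope $Q$, a linear objective function $c$ (to be minimized) is nondegenerate if no two vertices of $Q$ have the same objective value; each edge of $Q$ is then oriented toward its endpoint of smaller value. A $c$-monotone path is a directed path in this oriented graph from some vertex to the optimal vertex; its length is its number of edges. The $c$-monotone diameter of $Q$ is the maximum, over all starting vertices, of the length of a shortest $c$-monotone path from that vertex. The monotone diameter $\text{mono-diam}(Q)$ is the maximum of the $c$-monotone diameters over all nondegenerate linear objectives $c$. *)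

theory Defs
  imports "HOL-Analysis.Analysis" "HOL-Library.Extended_Nat"
begin

definition nondegenerate :: "'a::euclidean_space set \<Rightarrow> 'a \<Rightarrow> bool" where
  "nondegenerate Q c \<longleftrightarrow> inj_on (\<lambda>x. c \<bullet> x) {x. x extreme_point_of Q}"

definition optimal_vertex :: "'a::euclidean_space set \<Rightarrow> 'a \<Rightarrow> 'a \<Rightarrow> bool" where
  "optimal_vertex Q c w \<longleftrightarrow> w extreme_point_of Q \<and> is_arg_min (\<lambda>x. c \<bullet> x) (\<lambda>x. x \<in> Q) w"

definition oriented_edge :: "'a::euclidean_space set \<Rightarrow> 'a \<Rightarrow> 'a \<Rightarrow> 'a \<Rightarrow> bool" where
  "oriented_edge Q c x y \<longleftrightarrow> closed_segment x y edge_of Q \<and> c \<bullet> y < c \<bullet> x"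

text \<open>A path is given by the list of vertices it visits, so its length (the number of its
  edges) is one less than the length of the list. The one-element list is the path of length 0.\<close>

definition monotone_path :: "'a::euclidean_space set \<Rightarrow> 'a \<Rightarrow> 'a list \<Rightarrow> bool" where
  "monotone_path Q c xs \<longleftrightarrow>
     xs \<noteq> [] \<and> (\<forall>x\<in>set xs. x extreme_point_of Q) \<and>
     successively (oriented_edge Q c) xs \<and> optimal_vertex Q c (last xs)"

text \<open>The minimum and the maxima below are taken in the complete linear order of extended naturals:
  the distance is infinite if there is no monotone path, and a supremum that is finite and
  taken over a nonempty set is a maximum. The empty polytope gets monotone diameter 0.\<close>

definition monotone_distance :: "'a::euclidean_space set \<Rightarrow> 'a \<Rightarrow> 'a \<Rightarrow> enat" where
  "monotone_distance Q c v =
     (INF xs \<in> {xs. monotone_path Q c xs \<and> hd xs = v}. enat (length xs - 1))"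

definition monotone_diameter_wrt :: "'a::euclidean_space set \<Rightarrow> 'a \<Rightarrow> enat" where
  "monotone_diameter_wrt Q c = (SUP v \<in> {v. v extreme_point_of Q}. monotone_distance Q c v)"

definition mono_diam :: "'a::euclidean_space set \<Rightarrow> enat" where
  "mono_diam Q = (SUP c \<in> {c. nondegenerate Q c}. monotone_diameter_wrt Q c)"

text \<open>The direction of an edge is the line through the origin parallel to it; thus parallel edges
  have the same direction, regardless of orientation and length.\<close>

definition direction :: "'a::euclidean_space set \<Rightarrow> 'a set" where
  "direction e = span {x - y | x y. x \<in> e \<and> y \<in> e}"

definition edge_directions :: "'a::euclidean_space set \<Rightarrow> 'a set set" where
  "edge_directions P = direction ` {e. e edge_of P}"

definition contains_edge_directions :: "'a::euclidean_space set \<Rightarrow> 'a set \<Rightarrow> bool" where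
  "contains_edge_directions P E \<longleftrightarrow> (\<forall>L\<in>edge_directions P. \<exists>v\<in>E. span {v} = L)"

definition minimal_edge_direction_set :: "'a::euclidean_space set \<Rightarrow> 'a set \<Rightarrow> bool" where
  "minimal_edge_direction_set P E \<longleftrightarrow>
     finite E \<and> contains_edge_directions P E \<and> (\<forall>E'. E' \<subset> E \<longrightarrow> \<not> contains_edge_directions P E')"

text \<open>The sum is the Minkowski sum of sets, from Set_Algebras.\<close>

definition zonotope :: "'a::euclidean_space set \<Rightarrow> 'a set" where
  "zonotope E = (\<Sum>v\<in>E. closed_segment 0 v)"

end

theory Submission
  imports Defs
begin

text \<open>
  For the upper bound, let \<open>c\<close> be a nondegenerate objective and let \<open>w\<close> be a generic functional
  minimized over \<open>P\<close> only at the starting vertex. As \<open>t\<close> grows from \<open>0\<close>, the minimizers of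
  \<open>w + t c\<close> trace a \<open>c\<close>-monotone path, and an edge of direction \<open>d\<close> can be traversed only at
  the one \<open>t\<close> with \<open>(w + t c) \<bullet> d = 0\<close>. By genericity these values differ for different
  directions, so every edge direction is used at most once.

  For the lower bound, every vertex of \<open>zonotope E\<close> is the sum of a unique subset of \<open>E\<close>, and the
  endpoints of an edge differ in exactly one generator. For a generic objective the maximal and the
  minimal vertex belong to complementary subsets, so a path between them has at least \<open>card E\<close> edges.
\<close>

section \<open>Edges of polytopes\<close>

text \<open>Finitely many hyperplanes form a null set and cannot cover a nonempty open set. The
  generic functionals of both bounds are obtained this way.\<close>

lemma exists_inner_nonzero:
  fixes D U :: "'a::euclidean_space set"
  assumes "finite D" "0 \<notin> D" "open U" "U \<noteq> {}"
  obtains w where "w \<in> U" "\<And>d. d \<in> D \<Longrightarrow> w \<bullet> d \<noteq> 0"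
proof -
  have "negligible (\<Union>d\<in>D. {x. d \<bullet> x = 0})"
    using assms(1,2) by (intro negligible_Union) (auto intro!: negligible_hyperplane)
  then have "\<not> U \<subseteq> (\<Union>d\<in>D. {x. d \<bullet> x = 0})"
    using assms(3,4) negligible_subset open_not_negligible by blast
  then obtain w where "w \<in> U" "w \<notin> (\<Union>d\<in>D. {x. d \<bullet> x = 0})"
    by blast
  then show thesis
    using that[of w] by (simp add: inner_commute)
qed

lemma polytope_eq_convex_hull_extreme_points:
  fixes P :: "'a::euclidean_space set"
  assumes "polytope P"
  shows "P = convex hull {x. x extreme_point_of P}"
  using assms by (intro Krein_Milman_Minkowski polytope_imp_compact polytope_imp_convex)

lemma finite_polytope_extreme_points:
  fixes P :: "'a::euclidean_space set"
  assumes "polytope P"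
  shows "finite {x. x extreme_point_of P}"
  using assms by (intro finite_polyhedron_extreme_points polytope_imp_polyhedron)

lemma polytope_inner_ge:
  fixes P :: "'a::euclidean_space set"
  assumes "polytope P" "\<And>x. x extreme_point_of P \<Longrightarrow> r \<le> c \<bullet> x" "x \<in> P"
  shows "r \<le> c \<bullet> x"
proof -
  have "convex hull {x. x extreme_point_of P} \<subseteq> {x. r \<le> c \<bullet> x}"
    by (intro hull_minimal) (use assms(2) in \<open>auto simp: convex_halfspace_ge\<close>)
  then show ?thesis
    using assms polytope_eq_convex_hull_extreme_points by blast
qed

text \<open>Every face of a polyhedron is exposed, in particular a vertex. The negative of
  \<open>a\<close> later serves as a functional minimized only at \<open>v\<close>.\<close>

lemma extreme_point_exposed:
  fixes P :: "'a::euclidean_space set"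
  assumes "polytope P" "v extreme_point_of P"
  obtains a where "\<And>x. x \<in> P \<Longrightarrow> x \<noteq> v \<Longrightarrow> a \<bullet> x < a \<bullet> v"
proof -
  have "{v} exposed_face_of P"
    using assms by (simp add: exposed_face_of_polyhedron face_of_singleton polytope_imp_polyhedron)
  then obtain a b where ab: "P \<subseteq> {x. a \<bullet> x \<le> b}" "{v} = P \<inter> {x. a \<bullet> x = b}"
    unfolding exposed_face_of_def by blast
  have "a \<bullet> x < a \<bullet> v" if "x \<in> P" "x \<noteq> v" for x
  proof -
    have "a \<bullet> v = b" "a \<bullet> x \<noteq> b" "a \<bullet> x \<le> b"
      using ab that by auto
    then show ?thesis by simp
  qed
  then show thesis using that by blast
qed

text \<open>A face of least dimension containing \<open>z\<close> works: otherwise \<open>z\<close>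
  would lie on one of its facets, which is a face of \<open>P\<close> of smaller dimension.\<close>

lemma face_with_rel_interior_point:
  fixes P :: "'a::euclidean_space set"
  assumes "polytope P" "z \<in> P"
  obtains F where "F face_of P" "z \<in> rel_interior F"
proof -
  have "P face_of P \<and> z \<in> P"
    using assms face_of_refl polytope_imp_convex by blast
  \<comment> \<open>The empty set has dimension -1, so the shift by one keeps \<open>nat\<close>
    injective on dimensions.\<close>
  then obtain F where F: "F face_of P" "z \<in> F"
    and least: "\<And>G. G face_of P \<Longrightarrow> z \<in> G \<Longrightarrow> nat (aff_dim F + 1) \<le> nat (aff_dim G + 1)"
    using ex_has_least_nat[of "\<lambda>F. F face_of P \<and> z \<in> F" P "\<lambda>F. nat (aff_dim F + 1)"] by blast
  have "z \<in> rel_interior F"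
  proof (rule ccontr)
    assume "z \<notin> rel_interior F"
    moreover have "polyhedron F"
      using F assms(1) face_of_polytope_polytope polytope_imp_polyhedron by blast
    ultimately obtain G where G: "G facet_of F" "z \<in> G"
      using F(2) rel_interior_of_polyhedron by blast
    then have "G face_of P"
      using F(1) face_of_trans facet_of_imp_face_of by blast
    from least[OF this G(2)] show False
      using G F(2) aff_dim_geq[of G] by (auto simp: facet_of_def)
  qed
  with F show thesis using that by blast
qed

text \<open>Cut \<open>P\<close> by a level set of \<open>f\<close> that contains no vertex. An extreme point of the slice lies in
  the relative interior of some face, and this face must be an edge crossing the level set.\<close>

lemma edge_nonconstant:
  fixes P :: "'a::euclidean_space set"
  assumes "polytope P" "x \<in> P" "y \<in> P" "f \<bullet> x < f \<bullet> y"
  obtains e p q where "e edge_of P" "p \<in> e" "q \<in> e" "f \<bullet> p \<noteq> f \<bullet> q"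
proof -
  let ?V = "{x. x extreme_point_of P}"
  have "infinite ({f \<bullet> x<..<f \<bullet> y} - (\<bullet>) f ` ?V)"
    using assms finite_polytope_extreme_points[OF assms(1)] by (intro Diff_infinite_finite) auto
  then obtain s where s: "f \<bullet> x < s" "s < f \<bullet> y" "s \<notin> (\<bullet>) f ` ?V"
    by (metis (no_types, lifting) DiffE finite.emptyI ex_in_conv greaterThanLessThan_iff)
  let ?S = "P \<inter> {z. f \<bullet> z = s}"
  have "connected P"
    using assms(1) convex_connected polytope_imp_convex by blast
  then have "?S \<noteq> {}"
    using connected_ivt_hyperplane[of P x y f s] assms s by fastforce
  moreover have "compact ?S" "convex ?S"
    using polytope_imp_compact[OF assms(1)] polytope_imp_convex[OF assms(1)]
    by (simp_all add: compact_Int_closed closed_hyperplane convex_Int convex_hyperplane)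
  ultimately obtain z where z: "z extreme_point_of ?S"
    using extreme_point_exists_convex by blast
  then have "z \<in> P" "f \<bullet> z = s"
    by (auto simp: extreme_point_of_def)
  obtain G where G: "G face_of P" "z \<in> rel_interior G"
    using face_with_rel_interior_point[OF assms(1) \<open>z \<in> P\<close>] by blast
  then have "z \<in> G"
    using rel_interior_subset by blast
  obtain r where r: "r > 0" "cball z r \<inter> affine hull G \<subseteq> G"
    using G(2) by (auto simp: mem_rel_interior_cball)
  \<comment> \<open>As \<open>z\<close> is relatively interior to \<open>G\<close>, a nonzero
    \<open>d\<close> would make \<open>z\<close> the midpoint of two points of the slice, against
    extremality.\<close>
  have slice: "d = 0" if "f \<bullet> d = 0" "\<And>t. z + t *\<^sub>R d \<in> affine hull G" for d
  proof (rule ccontr)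
    assume "d \<noteq> 0"
    define t where "t = r / norm d"
    have "t > 0"
      using \<open>d \<noteq> 0\<close> r by (simp add: t_def)
    have "z + t *\<^sub>R d \<in> G" "z + (-t) *\<^sub>R d \<in> G"
      using r that(2) \<open>d \<noteq> 0\<close> by (auto intro!: subsetD[OF r(2)] simp: dist_norm t_def simp del: scaleR_minus_left)
    then have "z + t *\<^sub>R d \<in> ?S" "z - t *\<^sub>R d \<in> ?S"
      using G(1) face_of_imp_subset \<open>f \<bullet> z = s\<close> that(1) by (fastforce simp: inner_simps)+
    moreover have "z \<in> open_segment (z + t *\<^sub>R d) (z - t *\<^sub>R d)"
      using \<open>d \<noteq> 0\<close> \<open>t > 0\<close> unfolding in_segment
      by (auto intro!: exI[of _ "1/2"] simp: algebra_simps scaleR_2 simp flip: scaleR_add_left)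
    ultimately show False
      using z unfolding extreme_point_of_def by blast
  qed
  \<comment> \<open>Otherwise \<open>z\<close> would be a vertex with value \<open>s\<close>, which
    was excluded.\<close>
  have "G \<noteq> {z}"
    using G(1) s(3) \<open>f \<bullet> z = s\<close> by (auto simp: face_of_singleton)
  then obtain p where p: "p \<in> G" "p \<noteq> z"
    using \<open>z \<in> G\<close> by blast
  have aff: "z + t *\<^sub>R (q - z + u *\<^sub>R (p - z)) \<in> affine hull G" if "q \<in> G" for t u q
  proof -
    have "z + t *\<^sub>R (q - z + u *\<^sub>R (p - z)) = (1 - t - t * u) *\<^sub>R z + t *\<^sub>R q + (t * u) *\<^sub>R p"
      by (simp add: algebra_simps)
    also have "\<dots> \<in> affine hull {z, q, p}"
      unfolding affine_hull_3
      by (intro CollectI exI[of _ "1 - t - t * u"] exI[of _ t] exI[of _ "t * u"]) simp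
    also have "\<dots> \<subseteq> affine hull G"
      using that \<open>z \<in> G\<close> p by (intro hull_mono) auto
    finally show ?thesis .
  qed
  have fp: "f \<bullet> (p - z) \<noteq> 0"
    using slice[of "p - z"] aff[OF p(1), of _ 0] p by auto
  have "G \<subseteq> affine hull {z, p}"
  proof
    fix q assume q: "q \<in> G"
    \<comment> \<open>With this coefficient \<open>f\<close> vanishes on the combination of
      \<open>q - z\<close> and \<open>p - z\<close> below, so \<open>slice\<close> puts
      \<open>q\<close> on the line through \<open>z\<close> and \<open>p\<close>.\<close>
    define u where "u = - (f \<bullet> (q - z)) / (f \<bullet> (p - z))"
    have "q - z + u *\<^sub>R (p - z) = 0"
      using fp aff[OF q] by (intro slice) (auto simp: u_def inner_simps)
    then have "q = (1 + u) *\<^sub>R z + (- u) *\<^sub>R p"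
      by (simp add: algebra_simps add_eq_0_iff)
    then show "q \<in> affine hull {z, p}"
      unfolding affine_hull_2 by (intro CollectI exI[of _ "1 + u"] exI[of _ "- u"]) simp
  qed
  then have "aff_dim G \<le> aff_dim {z, p}"
    using aff_dim_subset aff_dim_affine_hull by metis
  moreover have "aff_dim {z, p} \<le> aff_dim G"
    using p \<open>z \<in> G\<close> by (intro aff_dim_subset) auto
  ultimately have "G edge_of P"
    using G(1) p by (simp add: edge_of_def aff_dim_2)
  then show thesis
    using that[of G p z] p \<open>z \<in> G\<close> fp by (auto simp: inner_diff_right)
qed

lemma edge_of_polytope_segment:
  fixes P :: "'a::euclidean_space set"
  assumes "polytope P" "e edge_of P"
  obtains a b where "e = closed_segment a b" "a \<noteq> b" "a extreme_point_of P" "b extreme_point_of P"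
proof -
  have e: "e face_of P" "aff_dim e = 1"
    using assms(2) by (auto simp: edge_of_def)
  then have "polytope e"
    using assms(1) face_of_polytope_polytope by blast
  moreover have "e \<noteq> {}"
    using e by auto
  ultimately obtain a b where ab: "e = closed_segment a b"
    using e(2) compact_convex_collinear_segment[of e] polytope_imp_compact[of e]
      polytope_imp_convex[of e] by (auto simp: collinear_aff_dim)
  then have "a \<noteq> b"
    using e(2) by auto
  moreover have "a extreme_point_of P" "b extreme_point_of P"
    using extreme_point_of_face[OF e(1)] unfolding ab by (auto simp: extreme_point_of_segment)
  ultimately show thesis
    using that ab by blast
qed

lemma direction_closed_segment: "direction (closed_segment a b) = span {b - a}"
  for a b :: "'a::euclidean_space"
proof
  have "x - y \<in> span {b - a}" if xy: "x \<in> closed_segment a b" "y \<in> closed_segment a b" for x y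
  proof -
    obtain s t where st: "x = (1 - s) *\<^sub>R a + s *\<^sub>R b" "y = (1 - t) *\<^sub>R a + t *\<^sub>R b"
      using xy unfolding in_segment by blast
    have "x - y = (s - t) *\<^sub>R (b - a)"
      unfolding st by (simp add: algebra_simps)
    then show ?thesis
      by (simp add: span_base span_scale)
  qed
  then show "direction (closed_segment a b) \<subseteq> span {b - a}"
    unfolding direction_def by (intro span_minimal) auto
  show "span {b - a} \<subseteq> direction (closed_segment a b)"
    unfolding direction_def by (intro span_mono) auto
qed

section \<open>Monotone paths from parametric objectives\<close>

text \<open>A functional vanishing on \<open>d\<close> is constant on every edge, hence on
  \<open>F\<close> by \<open>edge_nonconstant\<close>. So \<open>F\<close> lies on a line, and its
  two given extreme points are its ends.\<close>

lemma edge_if_all_edges_parallel: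
  fixes F :: "'a::euclidean_space set"
  assumes "polytope F" "\<And>e. e edge_of F \<Longrightarrow> direction e = span {d}"
    and "v extreme_point_of F" "u extreme_point_of F" "v \<noteq> u"
  shows "F = closed_segment v u"
proof -
  have vu: "v \<in> F" "u \<in> F"
    using assms by (auto simp: extreme_point_of_def)
  have const: "f \<bullet> x = f \<bullet> y" if f: "f \<bullet> d = 0" and xy: "x \<in> F" "y \<in> F" for f x y
  proof (rule ccontr)
    assume "f \<bullet> x \<noteq> f \<bullet> y"
    then obtain e p q where e: "e edge_of F" "p \<in> e" "q \<in> e" "f \<bullet> p \<noteq> f \<bullet> q"
      using edge_nonconstant[OF assms(1)] xy by (metis linorder_neqE)
    then have "p - q \<in> direction e"
      unfolding direction_def by (intro span_base) blast
    then have "f \<bullet> (p - q) = 0"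
      using assms(2)[OF e(1)] f by (auto simp: span_singleton)
    with e show False
      by (simp add: inner_diff_right)
  qed
  have "F \<subseteq> affine hull {v, u}"
  proof
    fix x assume x: "x \<in> F"
    have par: "\<exists>k. y - v = k *\<^sub>R d" if y: "y \<in> F" for y
    proof -
      \<comment> \<open>The component of \<open>y - v\<close> orthogonal to \<open>d\<close>. Being
        constant on \<open>F\<close>, it is orthogonal to \<open>y - v\<close> too, hence to itself.
        For \<open>d = 0\<close> the quotient is 0 and \<open>f\<close> is
        \<open>y - v\<close>.\<close>
      define f where "f = (y - v) - (((y - v) \<bullet> d) / (d \<bullet> d)) *\<^sub>R d"
      have fd: "f \<bullet> d = 0"
        by (cases "d = 0") (simp_all add: f_def inner_diff_left)
      then have "f \<bullet> (y - v) = 0"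
        using const[OF fd y vu(1)] by (simp add: inner_diff_right)
      then have "f \<bullet> f = 0"
        using fd by (subst (2) f_def) (simp add: inner_diff_right)
      then have "f = 0"
        by simp
      then show ?thesis
        unfolding f_def by (metis right_minus_eq)
    qed
    obtain k l where kl: "x - v = k *\<^sub>R d" "u - v = l *\<^sub>R d"
      using par x vu by blast
    then have "l \<noteq> 0"
      using assms(5) by auto
    then have "x - v = (k / l) *\<^sub>R (u - v)"
      using kl by simp
    then have "x = (1 - k / l) *\<^sub>R v + (k / l) *\<^sub>R u"
      by (simp add: algebra_simps)
    then show "x \<in> affine hull {v, u}"
      unfolding affine_hull_2 by (intro CollectI exI[of _ "1 - k / l"] exI[of _ "k / l"]) simp
  qed
  then have "collinear F"
    by (metis collinear_affine_hull)
  then obtain a b where ab: "F = closed_segment a b"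
    using assms(1) vu compact_convex_collinear_segment[of F] polytope_imp_compact[of F]
      polytope_imp_convex[of F] by auto
  then have "{v, u} = {a, b}"
    using assms(3-5) by (auto simp: extreme_point_of_segment)
  then show ?thesis
    using ab by (metis closed_segment_eq)
qed

lemma optimal_vertex_if_no_better_vertex:
  fixes P :: "'a::euclidean_space set"
  assumes "polytope P" "v extreme_point_of P"
    and "\<And>x. x extreme_point_of P \<Longrightarrow> c \<bullet> v \<le> c \<bullet> x"
  shows "optimal_vertex P c v"
  using assms polytope_inner_ge[OF assms(1,3)]
  by (auto simp: optimal_vertex_def is_arg_min_def extreme_point_of_def not_less)

text \<open>Here \<open>t\<close> is the first value at which \<open>v\<close> stops being the unique minimizer of \<open>w + t c\<close>, and \<open>s\<close>
  is slightly larger.\<close>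

lemma shadow_pivot:
  fixes P :: "'a::euclidean_space set"
  assumes P: "polytope P"
    and D: "\<And>e. e edge_of P \<Longrightarrow> \<exists>d\<in>D. direction e = span {d}"
    and c: "\<And>d. d \<in> D \<Longrightarrow> c \<bullet> d \<noteq> 0"
    and gen: "\<And>d d'. d \<in> D \<Longrightarrow> d' \<in> D \<Longrightarrow> d \<noteq> d' \<Longrightarrow> (w \<bullet> d) * (c \<bullet> d') \<noteq> (w \<bullet> d') * (c \<bullet> d)"
    and v: "v extreme_point_of P"
    and wv: "\<And>x. x extreme_point_of P \<Longrightarrow> x \<noteq> v \<Longrightarrow> w \<bullet> v < w \<bullet> x"
    and u': "u' extreme_point_of P" "c \<bullet> u' < c \<bullet> v"
  shows "\<exists>u s t. 0 < t \<and> t < s \<and> (\<exists>d\<in>D. (w + t *\<^sub>R c) \<bullet> d = 0) \<and>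
    oriented_edge P c v u \<and> u extreme_point_of P \<and>
    (\<forall>x. x extreme_point_of P \<longrightarrow> x \<noteq> u \<longrightarrow> (w + s *\<^sub>R c) \<bullet> u < (w + s *\<^sub>R c) \<bullet> x)"
proof -
  let ?V = "{x. x extreme_point_of P}"
  let ?T = "{x. x extreme_point_of P \<and> c \<bullet> x < c \<bullet> v}"
  \<comment> \<open>For \<open>x\<close> in \<open>?T\<close>, the parameter at which
    \<open>x\<close> ties with \<open>v\<close>. Vertices outside \<open>?T\<close> never beat
    \<open>v\<close> at a positive parameter.\<close>
  define \<tau> where "\<tau> x = (w \<bullet> (x - v)) / (c \<bullet> (v - x))" for x
  have fin: "finite ?V"
    by (rule finite_polytope_extreme_points[OF P])
  then have "finite ?T"
    by (rule rev_finite_subset) auto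
  moreover have "?T \<noteq> {}"
    using u' by blast
  ultimately obtain u where u: "u \<in> ?T" "\<And>x. x \<in> ?T \<Longrightarrow> \<tau> u \<le> \<tau> x"
    by (metis (no_types, lifting) arg_min_if_finite(1) arg_min_least)
  define t where "t = \<tau> u"
  define g where "g = w + t *\<^sub>R c"
  have "u \<noteq> v"
    using u by auto
  have "t > 0"
    using u wv[of u] \<open>u \<noteq> v\<close> by (auto simp: t_def \<tau>_def inner_diff_right)
  have gu: "g \<bullet> u = g \<bullet> v"
    using u by (auto simp: g_def t_def \<tau>_def inner_simps field_simps)
  have gV: "g \<bullet> v \<le> g \<bullet> x" if x: "x extreme_point_of P" for x
  proof (cases "c \<bullet> x < c \<bullet> v")
    case True
    then have "t \<le> \<tau> x"
      using u(2) x by (auto simp: t_def)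
    with True show ?thesis
      by (auto simp: \<tau>_def g_def inner_simps field_simps)
  next
    case False
    then have "t * (c \<bullet> v) \<le> t * (c \<bullet> x)"
      using \<open>t > 0\<close> by simp
    moreover have "w \<bullet> v \<le> w \<bullet> x"
      using wv[OF x] by (cases "x = v") auto
    ultimately show ?thesis
      by (simp add: g_def inner_simps)
  qed
  define F where "F = P \<inter> {x. g \<bullet> x = g \<bullet> v}"
  have F: "F face_of P"
    unfolding F_def using polytope_inner_ge[OF P gV]
    by (intro face_of_Int_supporting_hyperplane_ge polytope_imp_convex P) auto
  then have "polytope F"
    using P face_of_polytope_polytope by blast
  have vuF: "v extreme_point_of F" "u extreme_point_of F"
    using F v u gu by (auto simp: extreme_point_of_face F_def extreme_point_of_def)
  have Fedge: "\<exists>d\<in>D. direction e = span {d} \<and> g \<bullet> d = 0" if e: "e edge_of F" for e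
  proof -
    have "e edge_of P"
      using e F face_of_trans by (auto simp: edge_of_def)
    then obtain d where d: "d \<in> D" "direction e = span {d}"
      using D by blast
    have "g \<bullet> x = g \<bullet> v" if "x \<in> e" for x
      using that edge_of_imp_subset[OF e] by (auto simp: F_def)
    then have "direction e \<subseteq> {x. g \<bullet> x = 0}"
      unfolding direction_def
      by (intro span_minimal) (auto simp: inner_diff_right subspace_hyperplane)
    then show ?thesis
      using d span_base[of d "{d}"] by blast
  qed
  \<comment> \<open>On two directions annihilated by \<open>g\<close>, the values of
    \<open>w\<close> and \<open>c\<close> would have the same ratio \<open>- t\<close>, against
    \<open>gen\<close>. So all edges of the optimal face \<open>F\<close> are parallel.\<close>
  have unique: "d = d'" if "d \<in> D" "d' \<in> D" "g \<bullet> d = 0" "g \<bullet> d' = 0" for d d'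
  proof (rule ccontr)
    assume "d \<noteq> d'"
    have "w \<bullet> d = - t * (c \<bullet> d)" "w \<bullet> d' = - t * (c \<bullet> d')"
      using that by (auto simp: g_def inner_simps)
    then show False
      using gen[OF that(1,2) \<open>d \<noteq> d'\<close>] by simp
  qed
  have "u \<in> F" "v \<in> F" "c \<bullet> u < c \<bullet> v"
    using u vuF by (simp_all add: extreme_point_of_def)
  then obtain e0 where "e0 edge_of F"
    using edge_nonconstant[OF \<open>polytope F\<close>] by metis
  then obtain d where d: "d \<in> D" "g \<bullet> d = 0"
    using Fedge by blast
  have "direction e = span {d}" if "e edge_of F" for e
    using Fedge[OF that] unique d by metis
  then have Fseg: "F = closed_segment v u"
    using \<open>u \<noteq> v\<close> by (intro edge_if_all_edges_parallel[OF \<open>polytope F\<close> _ vuF]) auto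
  then have "closed_segment v u edge_of P"
    using F \<open>u \<noteq> v\<close> by (auto simp: edge_of_def segment_convex_hull aff_dim_convex_hull aff_dim_2)
  then have oe: "oriented_edge P c v u"
    using u by (simp add: oriented_edge_def)
  \<comment> \<open>Beyond \<open>t\<close> the vertex \<open>u\<close> beats \<open>v\<close>
    because its \<open>c\<close>-value is smaller. Any other vertex lies outside \<open>F\<close>,
    so it is strictly worse at \<open>t\<close> and stays so nearby.\<close>
  have "\<forall>\<^sub>F s in at_right t. (w + s *\<^sub>R c) \<bullet> u < (w + s *\<^sub>R c) \<bullet> x"
    if x: "x \<in> ?V - {u}" for x
  proof (cases "x = v")
    case True
    have "(w + s *\<^sub>R c) \<bullet> u < (w + s *\<^sub>R c) \<bullet> v" if "s > t" for s
    proof -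
      have "(s - t) * (c \<bullet> u) < (s - t) * (c \<bullet> v)"
        using u that by simp
      then show ?thesis
        using gu by (simp add: g_def inner_simps algebra_simps)
    qed
    then show ?thesis
      using True by (auto simp: eventually_at_filter)
  next
    case False
    have "x \<notin> F"
      using x False Fseg F extreme_point_of_face[OF F, of x] by (auto simp: extreme_point_of_segment)
    then have "g \<bullet> u < g \<bullet> x"
      using x gu gV[of x] by (auto simp: F_def extreme_point_of_def)
    then have "0 < (w + t *\<^sub>R c) \<bullet> x - (w + t *\<^sub>R c) \<bullet> u"
      by (simp add: g_def)
    moreover have "((\<lambda>s. (w + s *\<^sub>R c) \<bullet> x - (w + s *\<^sub>R c) \<bullet> u) \<longlongrightarrow>
        (w + t *\<^sub>R c) \<bullet> x - (w + t *\<^sub>R c) \<bullet> u) (at_right t)"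
      by (intro tendsto_intros)
    ultimately have "\<forall>\<^sub>F s in at_right t. 0 < (w + s *\<^sub>R c) \<bullet> x - (w + s *\<^sub>R c) \<bullet> u"
      by (rule order_tendstoD(1)[rotated])
    then show ?thesis
      by simp
  qed
  then have "\<forall>\<^sub>F s in at_right t. \<forall>x\<in>?V - {u}. (w + s *\<^sub>R c) \<bullet> u < (w + s *\<^sub>R c) \<bullet> x"
    using fin by (intro eventually_ball_finite) auto
  then have "\<forall>\<^sub>F s in at_right t. t < s \<and> (\<forall>x\<in>?V - {u}. (w + s *\<^sub>R c) \<bullet> u < (w + s *\<^sub>R c) \<bullet> x)"
    by (intro eventually_conj eventually_at_right_less)
  then obtain s where s: "t < s" "\<And>x. x \<in> ?V - {u} \<Longrightarrow> (w + s *\<^sub>R c) \<bullet> u < (w + s *\<^sub>R c) \<bullet> x"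
    using eventually_happens[of _ "at_right t"] by fastforce
  have "\<exists>d\<in>D. (w + t *\<^sub>R c) \<bullet> d = 0"
    using d by (auto simp: g_def)
  then show ?thesis
    using s u \<open>t > 0\<close> oe by blast
qed

text \<open>The induction counts the directions \<open>d\<close> with \<open>w \<bullet> d\<close> and \<open>c \<bullet> d\<close> of opposite signs. The pivot
  replaces \<open>w\<close> by \<open>w + s c\<close>, which removes the traversed direction and creates no new one.\<close>

lemma shadow_path:
  fixes P :: "'a::euclidean_space set"
  assumes P: "polytope P" and "finite D"
    and D: "\<And>e. e edge_of P \<Longrightarrow> \<exists>d\<in>D. direction e = span {d}"
    and c: "\<And>d. d \<in> D \<Longrightarrow> c \<bullet> d \<noteq> 0"
    and gen: "\<And>d d'. d \<in> D \<Longrightarrow> d' \<in> D \<Longrightarrow> d \<noteq> d' \<Longrightarrow> (w \<bullet> d) * (c \<bullet> d') \<noteq> (w \<bullet> d') * (c \<bullet> d)"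
    and v: "v extreme_point_of P"
    and wv: "\<And>x. x extreme_point_of P \<Longrightarrow> x \<noteq> v \<Longrightarrow> w \<bullet> v < w \<bullet> x"
  shows "\<exists>xs. monotone_path P c xs \<and> hd xs = v
    \<and> length xs - 1 \<le> card {d \<in> D. (w \<bullet> d) * (c \<bullet> d) < 0}"
  using gen v wv
proof (induction "card {d \<in> D. (w \<bullet> d) * (c \<bullet> d) < 0}" arbitrary: w v rule: less_induct)
  case less
  show ?case
  proof (cases "\<exists>u'. u' extreme_point_of P \<and> c \<bullet> u' < c \<bullet> v")
    case False
    then have "optimal_vertex P c v"
      using optimal_vertex_if_no_better_vertex[OF P less.prems(2)] by (meson not_less)
    then show ?thesis
      using less.prems(2) by (intro exI[of _ "[v]"]) (auto simp: monotone_path_def)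
  next
    case True
    then obtain u' where u': "u' extreme_point_of P" "c \<bullet> u' < c \<bullet> v"
      by blast
    have "\<exists>u s t. 0 < t \<and> t < s \<and> (\<exists>d\<in>D. (w + t *\<^sub>R c) \<bullet> d = 0) \<and>
      oriented_edge P c v u \<and> u extreme_point_of P \<and>
      (\<forall>x. x extreme_point_of P \<longrightarrow> x \<noteq> u \<longrightarrow> (w + s *\<^sub>R c) \<bullet> u < (w + s *\<^sub>R c) \<bullet> x)"
      by (rule shadow_pivot[of P D c w v u']) (fact P D c less.prems u')+
    then obtain u s t d where *: "t < s" "d \<in> D" "(w + t *\<^sub>R c) \<bullet> d = 0" "0 < t"
      "oriented_edge P c v u" "u extreme_point_of P"
      "\<And>x. x extreme_point_of P \<Longrightarrow> x \<noteq> u \<Longrightarrow> (w + s *\<^sub>R c) \<bullet> u < (w + s *\<^sub>R c) \<bullet> x"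
      by blast
    define w' where "w' = w + s *\<^sub>R c"
    let ?N = "\<lambda>w. {d \<in> D. (w \<bullet> d) * (c \<bullet> d) < 0}"
    \<comment> \<open>The added term is nonnegative, so no product becomes negative. For the
      traversed direction the total is nonnegative because \<open>t < s\<close>.\<close>
    have expand: "(w' \<bullet> d) * (c \<bullet> d) = (w \<bullet> d) * (c \<bullet> d) + s * (c \<bullet> d)\<^sup>2" for d
      by (simp add: w'_def inner_simps power2_eq_square algebra_simps)
    have "?N w' \<subseteq> ?N w"
    proof
      fix d assume "d \<in> ?N w'"
      moreover have "s * (c \<bullet> d)\<^sup>2 \<ge> 0"
        using * by simp
      ultimately show "d \<in> ?N w"
        by (simp add: expand)
    qed
    moreover have wd: "(w \<bullet> d) * (c \<bullet> d) = - t * (c \<bullet> d)\<^sup>2"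
    proof -
      have "w \<bullet> d = - t * (c \<bullet> d)"
        using *(3) by (simp add: inner_simps)
      then show ?thesis
        by (simp add: power2_eq_square)
    qed
    have "d \<in> ?N w"
      using *(2,4) c[OF *(2)] by (simp add: wd)
    moreover have "d \<notin> ?N w'"
    proof -
      have "(w' \<bullet> d) * (c \<bullet> d) = (s - t) * (c \<bullet> d)\<^sup>2"
        unfolding expand wd by (simp add: algebra_simps)
      moreover have "(s - t) * (c \<bullet> d)\<^sup>2 \<ge> 0"
        using *(1) by simp
      ultimately show ?thesis
        by simp
    qed
    ultimately have "?N w' \<subset> ?N w"
      by blast
    then have less_card: "card (?N w') < card (?N w)"
      using \<open>finite D\<close> by (intro psubset_card_mono) auto
    have "\<exists>xs. monotone_path P c xs \<and> hd xs = u \<and> length xs - 1 \<le> card (?N w')"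
    proof (rule less.hyps[OF less_card])
      \<comment> \<open>Adding a multiple of \<open>c\<close> to \<open>w\<close> contributes the
        same term to both sides, so genericity persists.\<close>
      show "(w' \<bullet> d) * (c \<bullet> d') \<noteq> (w' \<bullet> d') * (c \<bullet> d)" if "d \<in> D" "d' \<in> D" "d \<noteq> d'" for d d'
        using less.prems(1)[OF that] by (simp add: w'_def inner_simps algebra_simps)
    qed (use * w'_def in auto)
    then obtain xs where xs: "monotone_path P c xs" "hd xs = u" "length xs - 1 \<le> card (?N w')"
      by blast
    then have "monotone_path P c (v # xs)"
      using *(5) less.prems(2) by (auto simp: monotone_path_def successively_Cons)
    moreover have "length (v # xs) - 1 \<le> card (?N w)"
      using xs less_card by (cases xs) auto
    ultimately show ?thesis
      by (intro exI[of _ "v # xs"]) simp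
  qed
qed

section \<open>Upper bound for arbitrary polytopes\<close>

lemma finite_edge_directions:
  fixes P :: "'a::euclidean_space set"
  assumes "polytope P"
  shows "finite (edge_directions P)"
proof -
  have "finite {e. e edge_of P}"
    by (rule finite_subset[OF _ finite_polytope_faces[OF assms]]) (auto simp: edge_of_def)
  then show ?thesis
    by (simp add: edge_directions_def)
qed

text \<open>The difference of the endpoints generates the direction, and a nondegenerate objective
  separates the endpoints, which are distinct vertices.\<close>

lemma edge_direction_generator:
  fixes P :: "'a::euclidean_space set"
  assumes "polytope P" "L \<in> edge_directions P"
  obtains d where "L = span {d}"
    "\<And>c. nondegenerate P c \<Longrightarrow> c \<bullet> d \<noteq> 0"
proof -
  obtain e where e: "e edge_of P" "L = direction e"
    using assms(2) by (auto simp: edge_directions_def)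
  obtain a b where ab: "e = closed_segment a b" "a \<noteq> b" "a extreme_point_of P" "b extreme_point_of P"
    using edge_of_polytope_segment[OF assms(1) e(1)] .
  have "c \<bullet> (b - a) \<noteq> 0" if "nondegenerate P c" for c
    using that ab by (auto simp: nondegenerate_def inner_diff_right dest: inj_onD)
  moreover have "L = span {b - a}"
    using ab e by (simp_all add: direction_closed_segment)
  ultimately show thesis
    using that by blast
qed

text \<open>For every objective and starting vertex a generic \<open>w\<close> exists, so
  \<open>shadow_path\<close> applies with one generator per edge direction.\<close>

lemma mono_diam_le_card_edge_directions:
  fixes P :: "'a::euclidean_space set"
  assumes P: "polytope P"
  shows "mono_diam P \<le> enat (card (edge_directions P))"
  unfolding mono_diam_def monotone_diameter_wrt_def
proof (intro SUP_least)
  fix c v assume "c \<in> {c. nondegenerate P c}" "v \<in> {v. v extreme_point_of P}"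
  then have nd: "nondegenerate P c" and v: "v extreme_point_of P"
    by auto
  let ?V = "{x. x extreme_point_of P}"
  have "\<forall>L\<in>edge_directions P. \<exists>d. L = span {d} \<and> c \<bullet> d \<noteq> 0"
    using edge_direction_generator[OF P] nd by blast
  then obtain b where b: "\<And>L. L \<in> edge_directions P \<Longrightarrow> L = span {b L} \<and> c \<bullet> b L \<noteq> 0"
    by (auto dest!: bchoice)
  define D where "D = b ` edge_directions P"
  have finD: "finite D" and card: "card D \<le> card (edge_directions P)"
    using finite_edge_directions[OF P] by (auto simp: D_def card_image_le)
  have D: "\<exists>d\<in>D. direction e = span {d}" if "e edge_of P" for e
    using that b by (force simp: D_def edge_directions_def)
  have c: "c \<bullet> d \<noteq> 0" if "d \<in> D" for d
    using that b by (auto simp: D_def)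
  have par: "span {d} \<noteq> span {d'}" if "d \<in> D" "d' \<in> D" "d \<noteq> d'" for d d'
    using that b by (metis D_def imageE)
  \<comment> \<open>The functionals whose only minimizing vertex is \<open>v\<close>: finitely many
    strict inequalities, hence an open set.\<close>
  define U where "U = (\<Inter>x\<in>?V - {v}. {w. w \<bullet> v < w \<bullet> x})"
  have "open U"
    unfolding U_def using finite_polytope_extreme_points[OF P]
    by (intro open_INT ballI open_Collect_less continuous_intros) auto
  obtain a where a: "\<And>x. x \<in> P \<Longrightarrow> x \<noteq> v \<Longrightarrow> a \<bullet> x < a \<bullet> v"
    using extreme_point_exposed[OF P v] by blast
  then have "- a \<in> U"
    by (auto simp: U_def extreme_point_of_def)
  \<comment> \<open>Orthogonality of \<open>w\<close> to such a vector means that the directions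
    \<open>d\<close> and \<open>d'\<close> become orthogonal to \<open>w + t c\<close> at the same
    \<open>t\<close>.\<close>
  define R where "R = (\<lambda>(d, d'). (c \<bullet> d') *\<^sub>R d - (c \<bullet> d) *\<^sub>R d') ` {(d, d'). d \<in> D \<and> d' \<in> D \<and> d \<noteq> d'}"
  have "finite R"
    unfolding R_def by (intro finite_imageI finite_subset[OF _ finite_cartesian_product[OF finD finD]]) auto
  \<comment> \<open>A zero vector in \<open>R\<close> would make two generators of different
    directions parallel.\<close>
  moreover have "0 \<notin> R"
  proof
    assume "0 \<in> R"
    then obtain d d' where d: "d \<in> D" "d' \<in> D" "d \<noteq> d'" "(c \<bullet> d') *\<^sub>R d = (c \<bullet> d) *\<^sub>R d'"
      by (auto simp: R_def)
    have "span {(c \<bullet> d') *\<^sub>R d} = span {d}" "span {(c \<bullet> d) *\<^sub>R d'} = span {d'}"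
      using c d span_image_scale[of "{d}" "\<lambda>_. c \<bullet> d'"] span_image_scale[of "{d'}" "\<lambda>_. c \<bullet> d"]
      by auto
    with d par show False
      by metis
  qed
  ultimately obtain w where w: "w \<in> U" "\<And>r. r \<in> R \<Longrightarrow> w \<bullet> r \<noteq> 0"
    using exists_inner_nonzero[OF _ _ \<open>open U\<close>] \<open>- a \<in> U\<close> by blast
  have gen: "(w \<bullet> d) * (c \<bullet> d') \<noteq> (w \<bullet> d') * (c \<bullet> d)" if "d \<in> D" "d' \<in> D" "d \<noteq> d'" for d d'
  proof -
    have "(c \<bullet> d') *\<^sub>R d - (c \<bullet> d) *\<^sub>R d' \<in> R"
      using that by (auto simp: R_def)
    from w(2)[OF this] show ?thesis
      by (simp add: inner_simps mult.commute)
  qed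
  obtain xs where xs: "monotone_path P c xs" "hd xs = v"
    "length xs - 1 \<le> card {d \<in> D. (w \<bullet> d) * (c \<bullet> d) < 0}"
    using shadow_path[OF P finD D c gen v] w(1) by (auto simp: U_def)
  have "card {d \<in> D. (w \<bullet> d) * (c \<bullet> d) < 0} \<le> card D"
    using finD by (intro card_mono) auto
  then have "enat (length xs - 1) \<le> enat (card (edge_directions P))"
    using xs(3) card by simp
  then show "monotone_distance P c v \<le> enat (card (edge_directions P))"
    unfolding monotone_distance_def using xs(1,2) by (intro INF_lower2[of xs]) auto
qed

section \<open>Vertices and edges of zonotopes\<close>

lemma mem_zonotope:
  fixes E :: "'a::euclidean_space set"
  assumes "finite E"
  shows "x \<in> zonotope E \<longleftrightarrow> (\<exists>l. (\<forall>e\<in>E. 0 \<le> l e \<and> l e \<le> 1) \<and> x = (\<Sum>e\<in>E. l e *\<^sub>R e))"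
proof
  assume "x \<in> zonotope E"
  then obtain s where s: "x = sum s E" "\<forall>e\<in>E. s e \<in> closed_segment 0 e"
    unfolding zonotope_def set_sum_alt[OF assms] by blast
  then have "\<forall>e\<in>E. \<exists>l. 0 \<le> l \<and> l \<le> 1 \<and> s e = l *\<^sub>R e"
    by (auto simp: in_segment)
  then obtain l where "\<forall>e\<in>E. 0 \<le> l e \<and> l e \<le> 1 \<and> s e = l e *\<^sub>R e"
    by metis
  with s(1) show "\<exists>l. (\<forall>e\<in>E. 0 \<le> l e \<and> l e \<le> 1) \<and> x = (\<Sum>e\<in>E. l e *\<^sub>R e)"
    by (intro exI[of _ l]) (auto intro: sum.cong)
next
  assume "\<exists>l. (\<forall>e\<in>E. 0 \<le> l e \<and> l e \<le> 1) \<and> x = (\<Sum>e\<in>E. l e *\<^sub>R e)"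
  then show "x \<in> zonotope E"
    unfolding zonotope_def set_sum_alt[OF assms] by (force simp: in_segment)
qed

text \<open>Convex hulls commute with Minkowski sums. For finite \<open>E\<close> this exhibits the
  zonotope as the hull of the subset sums.\<close>

lemma zonotope_eq_convex_hull:
  "zonotope E = convex hull (\<Sum>v\<in>E. {0, v})"
  unfolding zonotope_def convex_hull_set_sum by (simp add: segment_convex_hull)

lemma polytope_zonotope:
  assumes "finite E"
  shows "polytope (zonotope E)"
proof -
  have "finite (\<Sum>v\<in>E. {0, v})"
    using assms by induction (auto intro: finite_set_plus)
  then show ?thesis
    unfolding zonotope_eq_convex_hull by (rule polytope_convex_hull)
qed

lemma sum_in_zonotope:
  fixes E :: "'a::euclidean_space set"
  assumes "finite E" "S \<subseteq> E"
  shows "\<Sum>S \<in> zonotope E"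
  unfolding mem_zonotope[OF assms(1)] using assms
  by (intro exI[of _ "\<lambda>e. if e \<in> S then 1 else 0"] conjI sum.mono_neutral_cong_left) auto

text \<open>Extreme points of a convex hull belong to the generating set, here the subset
  sums.\<close>

lemma extreme_point_of_zonotope:
  fixes E :: "'a::euclidean_space set"
  assumes "finite E" "x extreme_point_of zonotope E"
  obtains S where "S \<subseteq> E" "x = \<Sum>S"
proof -
  have "x \<in> (\<Sum>v\<in>E. {0, v})"
    using assms(2) extreme_point_of_convex_hull unfolding zonotope_eq_convex_hull by blast
  then obtain s where s: "x = sum s E" "\<forall>v\<in>E. s v \<in> {0, v}"
    unfolding set_sum_alt[OF assms(1)] by blast
  have "\<Sum>{v \<in> E. s v = v} = sum s {v \<in> E. s v = v}"
    by (intro sum.cong) auto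
  also have "\<dots> = x"
    unfolding s(1) using s(2) assms(1) by (intro sum.mono_neutral_left) auto
  finally show thesis
    by (intro that[of "{v \<in> E. s v = v}"]) auto
qed

text \<open>If two subset sums agree and \<open>d\<close> lies in only one of the subsets, then the point is the
  midpoint of the two points obtained by removing and adding \<open>d\<close>.\<close>

lemma extreme_point_of_zonotope_unique:
  fixes E :: "'a::euclidean_space set"
  assumes "finite E" "0 \<notin> E" "\<Sum>S extreme_point_of zonotope E"
    and ST: "S \<subseteq> E" "T \<subseteq> E" "\<Sum>S = \<Sum>T"
  shows "S = T"
proof -
  \<comment> \<open>Stated for any two subsets with this sum, so that it gives both
    inclusions.\<close>
  have "A \<subseteq> B" if "A \<subseteq> E" "B \<subseteq> E" "\<Sum>A = \<Sum>S" "\<Sum>B = \<Sum>S" for A B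
  proof
    fix d assume "d \<in> A"
    show "d \<in> B"
    proof (rule ccontr)
      assume "d \<notin> B"
      have fin: "finite A" "finite B"
        using that assms(1) finite_subset by auto
      have "\<Sum>(A - {d}) = \<Sum>S - d" "\<Sum>(insert d B) = \<Sum>S + d"
        using fin \<open>d \<in> A\<close> \<open>d \<notin> B\<close> that by (auto simp: sum_diff1)
      moreover have "\<Sum>(A - {d}) \<in> zonotope E" "\<Sum>(insert d B) \<in> zonotope E"
        using that \<open>d \<in> A\<close> assms(1) by (auto intro!: sum_in_zonotope)
      ultimately have "\<Sum>S - d \<in> zonotope E" "\<Sum>S + d \<in> zonotope E"
        by auto
      moreover have "\<Sum>S \<in> open_segment (\<Sum>S - d) (\<Sum>S + d)"
      proof -
        have "d \<noteq> 0"
          using \<open>d \<in> A\<close> that(1) assms(2) by blast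
        moreover have "\<Sum>S - d = \<Sum>S + d \<longleftrightarrow> d = 0"
          by (simp add: diff_eq_eq add.assoc flip: scaleR_2)
        moreover have "\<Sum>S = midpoint (\<Sum>S - d) (\<Sum>S + d)"
          by (simp add: midpoint_def flip: scaleR_2)
        ultimately show ?thesis
          by (metis midpoint_in_open_segment)
      qed
      ultimately show False
        using assms(3) by (auto simp: extreme_point_of_def)
    qed
  qed
  then show ?thesis
    using ST by (metis subset_antisym)
qed

text \<open>To maximize \<open>a\<close>, take coefficient 1 where \<open>a\<close> is positive and
  0 where it is negative. The loss is a sum of nonnegative terms, so in case of equality only
  generators orthogonal to \<open>a\<close> have free coefficients.\<close>

lemma zonotope_maximizer_coeffs:
  fixes E :: "'a::euclidean_space set"
  assumes "finite E" "\<And>e. e \<in> E \<Longrightarrow> 0 \<le> l e \<and> l e \<le> 1"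
  shows "a \<bullet> (\<Sum>e\<in>E. l e *\<^sub>R e) \<le> a \<bullet> \<Sum>{e \<in> E. a \<bullet> e > 0}"
    and "a \<bullet> (\<Sum>e\<in>E. l e *\<^sub>R e) = a \<bullet> \<Sum>{e \<in> E. a \<bullet> e > 0} \<Longrightarrow>
      (\<Sum>e\<in>E. l e *\<^sub>R e) = \<Sum>{e \<in> E. a \<bullet> e > 0} + (\<Sum>e | e \<in> E \<and> a \<bullet> e = 0. l e *\<^sub>R e)"
proof -
  \<comment> \<open>Generators orthogonal to \<open>a\<close> get the default 0; their contribution
    to the point is the separate second sum.\<close>
  define m where "m e = (if a \<bullet> e > 0 then 1 else 0 :: real)" for e
  have A: "\<Sum>{e \<in> E. a \<bullet> e > 0} = (\<Sum>e\<in>E. m e *\<^sub>R e)"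
    using assms(1) by (simp add: m_def if_distrib[of "\<lambda>x. x *\<^sub>R _"] sum.If_cases Int_def cong: if_cong)
  have nonneg: "0 \<le> (m e - l e) * (a \<bullet> e)" if "e \<in> E" for e
    using assms(2)[OF that] by (auto simp: m_def mult_nonneg_nonpos not_less)
  have diff: "a \<bullet> (\<Sum>e\<in>E. m e *\<^sub>R e) - a \<bullet> (\<Sum>e\<in>E. l e *\<^sub>R e) = (\<Sum>e\<in>E. (m e - l e) * (a \<bullet> e))"
    by (simp add: inner_sum_right algebra_simps sum_subtractf)
  show "a \<bullet> (\<Sum>e\<in>E. l e *\<^sub>R e) \<le> a \<bullet> \<Sum>{e \<in> E. a \<bullet> e > 0}"
    using sum_nonneg[of E "\<lambda>e. (m e - l e) * (a \<bullet> e)"] nonneg diff unfolding A by simp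
  assume "a \<bullet> (\<Sum>e\<in>E. l e *\<^sub>R e) = a \<bullet> \<Sum>{e \<in> E. a \<bullet> e > 0}"
  then have "(\<Sum>e\<in>E. (m e - l e) * (a \<bullet> e)) = 0"
    using diff A by simp
  then have "\<forall>e\<in>E. (m e - l e) * (a \<bullet> e) = 0"
    using sum_nonneg_eq_0_iff[OF assms(1), of "\<lambda>e. (m e - l e) * (a \<bullet> e)"] nonneg by simp
  then have "l e *\<^sub>R e = m e *\<^sub>R e + (if a \<bullet> e = 0 then l e *\<^sub>R e else 0)" if "e \<in> E" for e
    using that by (auto simp: m_def)
  then have "(\<Sum>e\<in>E. l e *\<^sub>R e) = (\<Sum>e\<in>E. m e *\<^sub>R e) + (\<Sum>e\<in>E. if a \<bullet> e = 0 then l e *\<^sub>R e else 0)"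
    by (simp flip: sum.distrib)
  then show "(\<Sum>e\<in>E. l e *\<^sub>R e) = \<Sum>{e \<in> E. a \<bullet> e > 0} + (\<Sum>e | e \<in> E \<and> a \<bullet> e = 0. l e *\<^sub>R e)"
    using assms(1) A by (simp add: sum.If_cases Int_def)
qed

text \<open>With no generator orthogonal to \<open>a\<close>, the maximizer has no free coefficients
  and is unique.\<close>

lemma extreme_point_of_zonotope_generic:
  fixes E :: "'a::euclidean_space set"
  assumes "finite E" "\<And>e. e \<in> E \<Longrightarrow> a \<bullet> e \<noteq> 0"
  shows "\<Sum>{e \<in> E. a \<bullet> e > 0} extreme_point_of zonotope E"
proof (rule extreme_point_of_Int_supporting_hyperplane_le)
  let ?A = "{e \<in> E. a \<bullet> e > 0}"
  show "a \<bullet> x \<le> a \<bullet> \<Sum>?A" if "x \<in> zonotope E" for x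
    using that assms(1) zonotope_maximizer_coeffs(1) unfolding mem_zonotope[OF assms(1)] by blast
  have none: "{e \<in> E. a \<bullet> e = 0} = {}"
    using assms(2) by auto
  have "x = \<Sum>?A" if x: "x \<in> zonotope E" "a \<bullet> x = a \<bullet> \<Sum>?A" for x
  proof -
    obtain l where l: "\<And>e. e \<in> E \<Longrightarrow> 0 \<le> l e \<and> l e \<le> 1" "x = (\<Sum>e\<in>E. l e *\<^sub>R e)"
      using x(1) unfolding mem_zonotope[OF assms(1)] by blast
    show ?thesis
      using zonotope_maximizer_coeffs(2)[OF assms(1) l(1), where a = a] x(2)
      unfolding l(2) none by simp
  qed
  then show "zonotope E \<inter> {x. a \<bullet> x = a \<bullet> \<Sum>?A} = {\<Sum>?A}"
    using sum_in_zonotope[OF assms(1), of ?A] by auto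
qed

lemma span_singleton_eq:
  fixes d :: "'a::real_vector"
  assumes "d \<in> span {b}" "d \<noteq> 0"
  shows "span {d} = span {b}"
proof -
  obtain k where "d = k *\<^sub>R b"
    using assms(1) by (auto simp: span_singleton)
  then show ?thesis
    using assms(2) span_image_scale[of "{b}" "\<lambda>_. k"] by auto
qed

text \<open>If \<open>a\<close> exposes \<open>F\<close>, then \<open>F\<close> is the sum of the
  generators with positive value, translated by all combinations of the set \<open>K\<close> of
  orthogonal ones. Dimension one makes the members of \<open>K\<close> parallel, so injectivity of
  spans leaves just one.\<close>

lemma edge_of_zonotope:
  fixes E :: "'a::euclidean_space set"
  assumes E: "finite E" "0 \<notin> E" "inj_on (\<lambda>v. span {v}) E" and F: "F edge_of zonotope E"
  obtains S d where "S \<subseteq> E" "d \<in> E" "d \<notin> S" "F = closed_segment (\<Sum>S) (\<Sum>(insert d S))"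
proof -
  let ?Z = "zonotope E"
  have Z: "polytope ?Z"
    by (rule polytope_zonotope[OF E(1)])
  have face: "F face_of ?Z" "aff_dim F = 1"
    using F by (auto simp: edge_of_def)
  then have "F exposed_face_of ?Z"
    using Z by (simp add: exposed_face_of_polyhedron polytope_imp_polyhedron)
  then obtain a b where ab: "?Z \<subseteq> {x. a \<bullet> x \<le> b}" "F = ?Z \<inter> {x. a \<bullet> x = b}"
    unfolding exposed_face_of_def by blast
  define A where "A = {e \<in> E. a \<bullet> e > 0}"
  define K where "K = {e \<in> E. a \<bullet> e = 0}"
  have fin: "finite A" "finite K" and sub: "A \<subseteq> E" "K \<subseteq> E" and disj: "A \<inter> K = {}"
    using E(1) by (auto simp: A_def K_def)
  have "F \<noteq> {}"
    using face(2) by auto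
  then obtain x0 where "x0 \<in> F"
    by blast
  then obtain l where "\<And>e. e \<in> E \<Longrightarrow> 0 \<le> l e \<and> l e \<le> 1" "x0 = (\<Sum>e\<in>E. l e *\<^sub>R e)" "a \<bullet> x0 = b"
    unfolding ab(2) Int_iff mem_zonotope[OF E(1)] by blast
  then have "b \<le> a \<bullet> \<Sum>A"
    using zonotope_maximizer_coeffs(1)[OF E(1)] unfolding A_def by blast
  moreover have "a \<bullet> \<Sum>A \<le> b"
    using ab(1) sum_in_zonotope[OF E(1) sub(1)] by auto
  \<comment> \<open>The face is nonempty, so its level is the maximum of \<open>a\<close>, attained
    at \<open>\<Sum>A\<close>.\<close>
  ultimately have b: "b = a \<bullet> \<Sum>A"
    by simp
  have AF: "\<Sum>A \<in> F"
    unfolding ab(2) b using sum_in_zonotope[OF E(1) sub(1)] by simp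
  have AdF: "\<Sum>A + d \<in> F" if "d \<in> K" for d
  proof -
    have "\<Sum>(insert d A) = \<Sum>A + d"
      using fin disj that by (subst sum.insert) auto
    moreover have "\<Sum>(insert d A) \<in> ?Z"
      using that sub E(1) by (intro sum_in_zonotope) auto
    ultimately show ?thesis
      unfolding ab(2) b using that by (simp add: K_def inner_add_right)
  qed
  have Fsub: "\<exists>l. (\<forall>e\<in>K. 0 \<le> l e \<and> l e \<le> 1) \<and> x = \<Sum>A + (\<Sum>e\<in>K. l e *\<^sub>R e)" if "x \<in> F" for x
  proof -
    obtain l where l: "\<And>e. e \<in> E \<Longrightarrow> 0 \<le> l e \<and> l e \<le> 1" "x = (\<Sum>e\<in>E. l e *\<^sub>R e)" "a \<bullet> x = b"
      using \<open>x \<in> F\<close> unfolding ab(2) Int_iff mem_zonotope[OF E(1)] by blast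
    then have "x = \<Sum>A + (\<Sum>e\<in>K. l e *\<^sub>R e)"
      using zonotope_maximizer_coeffs(2)[OF E(1) l(1), where a = a] b by (simp add: A_def K_def)
    then show ?thesis
      using l(1) sub(2) by blast
  qed
  obtain p q where pq: "F = closed_segment p q" "p \<noteq> q"
    using edge_of_polytope_segment[OF Z F] by metis
  have "K \<noteq> {}"
  proof
    assume "K = {}"
    then have "p = \<Sum>A" "q = \<Sum>A"
      using Fsub[of p] Fsub[of q] pq(1) by auto
    then show False
      using pq(2) by simp
  qed
  then obtain d where d: "d \<in> K"
    by blast
  \<comment> \<open>Both \<open>\<Sum>A\<close> and \<open>\<Sum>A + d\<close> lie in
    \<open>F\<close>, so \<open>d\<close> is a nonzero vector on its direction.\<close>
  have spanK: "span {d} = span {q - p}" if d: "d \<in> K" for d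
  proof (rule span_singleton_eq)
    have "(\<Sum>A + d) - \<Sum>A \<in> direction F"
      unfolding direction_def using AF AdF[OF d] by (intro span_base) blast
    then show "d \<in> span {q - p}"
      by (simp add: pq(1) direction_closed_segment)
  qed (use d sub E(2) in auto)
  have Kd: "K = {d}"
  proof -
    have "d' = d" if "d' \<in> K" for d'
      using inj_onD[OF E(3), of d' d] spanK[OF that] spanK[OF d] that d sub by auto
    then show ?thesis
      using d by blast
  qed
  have "F = closed_segment (\<Sum>A) (\<Sum>A + d)"
  proof
    show "closed_segment (\<Sum>A) (\<Sum>A + d) \<subseteq> F"
      using AF AdF[OF d] face(1) by (intro closed_segment_subset face_of_imp_convex)
    show "F \<subseteq> closed_segment (\<Sum>A) (\<Sum>A + d)"
    proof
      fix x assume "x \<in> F"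
      then obtain u where u: "0 \<le> u" "u \<le> 1" "x = \<Sum>A + u *\<^sub>R d"
        using Fsub unfolding Kd by fastforce
      then have "x = (1 - u) *\<^sub>R \<Sum>A + u *\<^sub>R (\<Sum>A + d)"
        by (simp add: algebra_simps)
      then show "x \<in> closed_segment (\<Sum>A) (\<Sum>A + d)"
        unfolding in_segment using u(1,2) by blast
    qed
  qed
  moreover have "d \<notin> A"
    using d disj by blast
  moreover have "\<Sum>(insert d A) = \<Sum>A + d"
    using fin \<open>d \<notin> A\<close> by (simp add: add.commute)
  ultimately show thesis
    using that[of A d] d sub by auto
qed

text \<open>Every edge is a translate of a generator. With the upper bound for polytopes, this
  bounds the monotone diameter of the zonotope by \<open>card E\<close>.\<close>

lemma card_edge_directions_zonotope_le:
  fixes E :: "'a::euclidean_space set"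
  assumes "finite E" "0 \<notin> E" "inj_on (\<lambda>v. span {v}) E"
  shows "card (edge_directions (zonotope E)) \<le> card E"
proof (rule surj_card_le[where f = "\<lambda>v. span {v}"])
  show "edge_directions (zonotope E) \<subseteq> (\<lambda>v. span {v}) ` E"
  proof
    fix L assume "L \<in> edge_directions (zonotope E)"
    then obtain F where F: "F edge_of zonotope E" "L = direction F"
      by (auto simp: edge_directions_def)
    obtain S d where S: "S \<subseteq> E" "d \<in> E" "d \<notin> S" "F = closed_segment (\<Sum>S) (\<Sum>(insert d S))"
      using edge_of_zonotope[OF assms F(1)] .
    have "finite S"
      using S(1) assms(1) finite_subset by blast
    then have "L = span {d}"
      using S F(2) by (simp add: direction_closed_segment)
    then show "L \<in> (\<lambda>v. span {v}) ` E"
      using S(2) by blast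
  qed
qed (fact assms(1))

section \<open>Lower bound for zonotopes\<close>

text \<open>Each edge changes the subset of the current vertex by one generator, and symmetric
  differences satisfy the triangle inequality.\<close>

lemma card_sym_diff_le_path_length:
  fixes E :: "'a::euclidean_space set"
  assumes E: "finite E" "0 \<notin> E" "inj_on (\<lambda>v. span {v}) E"
    and "xs \<noteq> []" "\<forall>x\<in>set xs. x extreme_point_of zonotope E"
    "successively (oriented_edge (zonotope E) c) xs"
    and "S \<subseteq> E" "T \<subseteq> E" "hd xs = \<Sum>S" "last xs = \<Sum>T"
  shows "card (sym_diff S T) \<le> length xs - 1"
  using assms(4-)
proof (induction xs arbitrary: S)
  case Nil
  then show ?case by simp
next
  case (Cons x xs)
  show ?case
  proof (cases xs)
    case Nil
    then have "S = T"
      using Cons.prems by (intro extreme_point_of_zonotope_unique[OF E(1,2)]) auto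
    then show ?thesis by simp
  next
    case (Cons y ys)
    have oe: "closed_segment x y edge_of zonotope E"
      using Cons.prems(3) Cons by (simp add: oriented_edge_def)
    have ext: "x extreme_point_of zonotope E" "y extreme_point_of zonotope E"
      using Cons.prems(2) Cons by auto
    obtain Y where Y: "Y \<subseteq> E" "y = \<Sum>Y"
      using extreme_point_of_zonotope[OF E(1) ext(2)] .
    obtain B d where B: "B \<subseteq> E" "d \<in> E" "d \<notin> B"
      "closed_segment x y = closed_segment (\<Sum>B) (\<Sum>(insert d B))"
      using edge_of_zonotope[OF E oe] .
    have x: "x = \<Sum>S"
      using Cons.prems by simp
    have *: "R = S" if "R \<subseteq> E" "\<Sum>R = x" for R
      by (rule extreme_point_of_zonotope_unique[OF E(1,2), symmetric])
        (use that ext(1) x Cons.prems(4) in simp_all)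
    have **: "R = Y" if "R \<subseteq> E" "\<Sum>R = y" for R
      by (rule extreme_point_of_zonotope_unique[OF E(1,2), symmetric])
        (use that ext(2) Y in simp_all)
    \<comment> \<open>A segment determines its endpoints up to order; uniqueness of subsets then
      identifies \<open>S\<close> and \<open>Y\<close> with \<open>B\<close> and
      \<open>insert d B\<close> in some order.\<close>
    have "{x, y} = {\<Sum>B, \<Sum>(insert d B)}"
      using B(4) by simp
    then have "S = B \<and> Y = insert d B \<or> S = insert d B \<and> Y = B"
      using * ** B(1,2) by (metis doubleton_eq_iff insert_subset)
    then have "sym_diff S Y \<subseteq> {d}"
      by auto
    then have "card (sym_diff S Y) \<le> 1"
      using card_mono[of "{d}" "sym_diff S Y"] by simp
    moreover have "card (sym_diff Y T) \<le> length xs - 1"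
      using Cons.prems Cons Y by (intro Cons.IH) auto
    moreover have "card (sym_diff S T) \<le> card (sym_diff S Y \<union> sym_diff Y T)"
      using E(1) Y(1) Cons.prems(4,5) by (intro card_mono) (auto dest: finite_subset)
    moreover have "\<dots> \<le> card (sym_diff S Y) + card (sym_diff Y T)"
      by (rule card_Un_le)
    ultimately show ?thesis
      using Cons by simp
  qed
qed

text \<open>Dropping a generator of positive value or adding a missing one of negative value would
  improve the vertex.\<close>

lemma optimal_vertex_zonotope:
  fixes E :: "'a::euclidean_space set"
  assumes "finite E" "\<And>e. e \<in> E \<Longrightarrow> c \<bullet> e \<noteq> 0" "optimal_vertex (zonotope E) c (\<Sum>T)" "T \<subseteq> E"
  shows "T = {e \<in> E. c \<bullet> e < 0}"
proof -
  have "finite T"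
    using assms(1,4) finite_subset by blast
  have opt: "c \<bullet> \<Sum>T \<le> c \<bullet> \<Sum>S" if "S \<subseteq> E" for S
    using assms(3) sum_in_zonotope[OF assms(1) that]
    by (auto simp: optimal_vertex_def is_arg_min_def not_less)
  have "c \<bullet> e < 0" if "e \<in> T" for e
  proof -
    have "T - {e} \<subseteq> E" "c \<bullet> e \<noteq> 0"
      using assms(2,4) that by auto
    then show ?thesis
      using opt[of "T - {e}"] that \<open>finite T\<close> by (auto simp: sum_diff1 inner_diff_right)
  qed
  moreover have "e \<in> T" if "e \<in> E" "c \<bullet> e < 0" for e
    using opt[of "insert e T"] assms(4) that \<open>finite T\<close>
    by (cases "e \<in> T") (auto simp: inner_add_right)
  ultimately show ?thesis
    using assms(4) by blast
qed

lemma card_le_mono_diam_zonotope: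
  fixes E :: "'a::euclidean_space set"
  assumes E: "finite E" "0 \<notin> E" "inj_on (\<lambda>v. span {v}) E"
  shows "enat (card E) \<le> mono_diam (zonotope E)"
proof -
  let ?Z = "zonotope E" and ?V = "{x. x extreme_point_of zonotope E}"
  have finV: "finite ?V"
    by (rule finite_polytope_extreme_points[OF polytope_zonotope[OF E(1)]])
  \<comment> \<open>Avoiding the generators makes the subsets of the maximal and minimal vertices
    complementary; avoiding the vertex differences makes \<open>c\<close> nondegenerate.\<close>
  define D where "D = E \<union> ((\<lambda>(x, y). x - y) ` (?V \<times> ?V) - {0})"
  have "finite D" "0 \<notin> D"
    using E(1,2) finV by (auto simp: D_def)
  then obtain c where c: "\<And>d. d \<in> D \<Longrightarrow> c \<bullet> d \<noteq> 0"
    using exists_inner_nonzero[of D UNIV] by auto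
  have "nondegenerate ?Z c"
    unfolding nondegenerate_def
  proof (rule inj_onI, rule ccontr)
    fix x y assume xy: "x \<in> ?V" "y \<in> ?V" "c \<bullet> x = c \<bullet> y" "x \<noteq> y"
    then have "x - y \<in> D"
      by (force simp: D_def)
    from c[OF this] xy(3) show False
      by (simp add: inner_diff_right)
  qed
  have cE: "c \<bullet> e \<noteq> 0" if "e \<in> E" for e
    using c that by (simp add: D_def)
  define A where "A = {e \<in> E. c \<bullet> e > 0}"
  have A: "\<Sum>A extreme_point_of ?Z"
    unfolding A_def by (rule extreme_point_of_zonotope_generic[OF E(1) cE])
  have "enat (card E) \<le> monotone_distance ?Z c (\<Sum>A)"
    unfolding monotone_distance_def
  proof (rule INF_greatest)
    fix xs assume "xs \<in> {xs. monotone_path ?Z c xs \<and> hd xs = \<Sum>A}"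
    then have xs: "xs \<noteq> []" "\<forall>x\<in>set xs. x extreme_point_of ?Z"
      "successively (oriented_edge ?Z c) xs" "optimal_vertex ?Z c (last xs)" "hd xs = \<Sum>A"
      by (auto simp: monotone_path_def)
    then have "last xs extreme_point_of ?Z"
      by auto
    then obtain T where T: "T \<subseteq> E" "last xs = \<Sum>T"
      using extreme_point_of_zonotope[OF E(1)] by blast
    then have "T = {e \<in> E. c \<bullet> e < 0}"
      using optimal_vertex_zonotope[OF E(1) cE _ T(1)] xs(4) by auto
    then have "sym_diff A T = E"
      using cE by (auto simp: A_def not_less order.strict_iff_order)
    moreover have "card (sym_diff A T) \<le> length xs - 1"
      using xs T by (intro card_sym_diff_le_path_length[OF E]) (auto simp: A_def)
    ultimately show "enat (card E) \<le> enat (length xs - 1)"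
      by simp
  qed
  also have "\<dots> \<le> monotone_diameter_wrt ?Z c"
    unfolding monotone_diameter_wrt_def using A by (intro SUP_upper) simp
  also have "\<dots> \<le> mono_diam ?Z"
    unfolding mono_diam_def using \<open>nondegenerate ?Z c\<close> by (intro SUP_upper) simp
  finally show ?thesis .
qed

section \<open>Minimal direction sets and conclusion\<close>

text \<open>By minimality each member of \<open>E\<close> is the only one generating some edge
  direction. This makes its span an edge direction, different from the other spans.\<close>

lemma minimal_edge_direction_set_bij:
  fixes P :: "'a::euclidean_space set"
  assumes "minimal_edge_direction_set P E"
  shows "bij_betw (\<lambda>v. span {v}) E (edge_directions P)"
proof (rule bij_betwI')
  have cover: "\<And>L. L \<in> edge_directions P \<Longrightarrow> \<exists>v\<in>E. span {v} = L"
    using assms by (auto simp: minimal_edge_direction_set_def contains_edge_directions_def)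
  have needed: "\<exists>L\<in>edge_directions P. \<forall>u\<in>E - {v}. span {u} \<noteq> L" if "v \<in> E" for v
  proof -
    have "E - {v} \<subset> E"
      using that by blast
    then have "\<not> contains_edge_directions P (E - {v})"
      using assms by (simp add: minimal_edge_direction_set_def)
    then show ?thesis
      unfolding contains_edge_directions_def by blast
  qed
  show "span {v} \<in> edge_directions P" if "v \<in> E" for v
    using needed[OF that] cover by blast
  show "span {u} = span {v} \<longleftrightarrow> u = v" if "u \<in> E" "v \<in> E" for u v
    using needed[OF that(1)] cover that by (metis Diff_iff singletonD)
  show "\<exists>v\<in>E. L = span {v}" if "L \<in> edge_directions P" for L
    using cover[OF that] by blast
qed

theorem theorem1p3:
  fixes P E :: "(real ^ 'n) set"
  assumes "polytope P"
    and "minimal_edge_direction_set P E"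
  shows "mono_diam P \<le> mono_diam (zonotope E) \<and>
         mono_diam (zonotope E) = enat (card E) \<and>
         card E = card (edge_directions P)"
proof -
  have bij: "bij_betw (\<lambda>v. span {v}) E (edge_directions P)"
    by (rule minimal_edge_direction_set_bij[OF assms(2)])
  have "finite E"
    using assms(2) by (simp add: minimal_edge_direction_set_def)
  \<comment> \<open>The span of 0 is trivial, but an edge has two distinct endpoints.\<close>
  moreover have "0 \<notin> E"
  proof
    assume "0 \<in> E"
    then have "{0} \<in> edge_directions P"
      using bij_betwE[OF bij] by force
    then obtain e where e: "e edge_of P" "direction e = {0}"
      by (auto simp: edge_directions_def)
    obtain a b where "e = closed_segment a b" "a \<noteq> b"
      using edge_of_polytope_segment[OF assms(1) e(1)] by metis
    then show False
      using e(2) span_base[of "b - a" "{b - a}"] by (simp add: direction_closed_segment)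
  qed
  moreover have "inj_on (\<lambda>v. span {v}) E"
    using bij by (rule bij_betw_imp_inj_on)
  ultimately have E: "finite E" "0 \<notin> E" "inj_on (\<lambda>v. span {v}) E"
    by blast+
  have card: "card E = card (edge_directions P)"
    by (rule bij_betw_same_card[OF bij])
  \<comment> \<open>The upper bound for polytopes is applied to the zonotope itself.\<close>
  have "mono_diam (zonotope E) \<le> enat (card (edge_directions (zonotope E)))"
    by (rule mono_diam_le_card_edge_directions[OF polytope_zonotope[OF E(1)]])
  also have "\<dots> \<le> enat (card E)"
    using card_edge_directions_zonotope_le[OF E] by simp
  finally have "mono_diam (zonotope E) = enat (card E)"
    using card_le_mono_diam_zonotope[OF E] by (rule antisym)
  then show ?thesis
    using mono_diam_le_card_edge_directions[OF assms(1)] card by simp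
qed

end
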